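(* Let $(W,S)$ be a Coxeter system, $Q=(\sigma_1,\ldots,\sigma_n)$ a word of size $n$ in $S$, $\pi\in W$, and let $\Delta=\Delta(Q,\pi)$ be the subword complex. Let $k$ be a field. Then the Stanley--Reisner ideal $I_{\Delta^{\vee}}\subseteq k[x_1,\ldots,x_n]$ of the Alexander dual of $\Delta$ has linear quotients with respect to the lexicographical order of its minimal monomial generators. That is, if $G(I_{\Delta^{\vee}})=\{\mathbf{x}_{P_1},\ldots,\mathbf{x}_{P_r}\}$ with $\mathbf{x}_{P_1}>_{lex}\cdots>_{lex}\mathbf{x}_{P_r}$, then $I_{\Delta^{\vee}}$ has linear quotients with respect to the sequence $\mathbf{x}_{P_1},\ldots,\mathbf{x}_{P_r}$.
   Context: A word $Q=(\sigma_1,\ldots,\sigma_n)$ of size $n$ is an ordered sequence of elements of the set $S$ of simple reflections. A subword $P$ of $Q$ is an ordered subsequence, identified with its set of positions in $[n]=\{1,\ldots,n\}$ (so occurrences of the same reflection at different positions are distinguished). $P$ represents $\pi$ if the ordered product of the simple reflections in $P$ is a reduced expression for $\pi$; $P$ contains $\pi$ if some subsequence of $P$ represents $\pi$. The subword complex $\Delta(Q,\pi)$ is the simplicial complex (on the $n$ positions of $Q$) of all subwords $Q\setminus P$ such that $P$ contains $\pi$. For a subword $P=(\sigma_{i_1},\ldots,\sigma_{i_m})$ of $Q$ put $\mathbf{x}_P=x_{i_1}\cdots x_{i_m}$. For a simplicial complex $\Delta$ on $[n]$ with set of facets $\mathcal{F}(\Delta)$, $I_{\Delta^\vee}=(\mathbf{x}_{[n]\setminus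 F}\mid F\in\mathcal{F}(\Delta))$; for $\Delta=\Delta(Q,\pi)$ this is $I_{\Delta^\vee}=(\mathbf{x}_P\mid P\subseteq Q,\ P\text{ represents }\pi)$. $G(I)$ denotes the minimal monomial generating set of a monomial ideal $I$, and $>_{lex}$ is the lexicographical order with $x_1>\cdots>x_n$. A monomial ideal $I$ has linear quotients with respect to the ordering $u_1,\ldots,u_m$ of $G(I)$ if for all $i\ge 2$ and all $j<i$ there exist $l\in[n]$ and $1\le k<i$ such that $u_k/\gcd(u_i,u_k)=x_l$ and $x_l$ divides $u_j/\gcd(u_i,u_j)$. *)

theory Defs
  imports "HOL-Algebra.Algebra" "HOL-Library.Poly_Mapping" "HOL-Library.Multiset"
begin

section \<open>Coxeter systems\<close>

text \<open>Words over the alphabet of letters \<open>s\<close> and formal inverses of letters: the pair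
  \<open>(s, True)\<close> stands for \<open>s\<close> and \<open>(s, False)\<close> for its inverse.\<close>

type_synonym 'a signed_word = "('a \<times> bool) list"

definition eval_signed_word :: "('a, 'b) monoid_scheme \<Rightarrow> 'a signed_word \<Rightarrow> 'a" where
  "eval_signed_word W w =
     foldr (\<lambda>(s, pos) g. (if pos then s else inv\<^bsub>W\<^esub> s) \<otimes>\<^bsub>W\<^esub> g) w \<one>\<^bsub>W\<^esub>"

text \<open>Equality of signed words in the abstract group \<open>\<langle>S | R\<rangle>\<close>.\<close>

inductive presentation_eq ::
  "'a set \<Rightarrow> 'a signed_word set \<Rightarrow> 'a signed_word \<Rightarrow> 'a signed_word \<Rightarrow> bool"
  for S R where
  refl: "presentation_eq S R u u"
| sym: "presentation_eq S R u v \<Longrightarrow> presentation_eq S R v u"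
| trans: "presentation_eq S R u v \<Longrightarrow> presentation_eq S R v w \<Longrightarrow> presentation_eq S R u w"
| cancel: "s \<in> S \<Longrightarrow> presentation_eq S R (u @ [(s, pos), (s, \<not> pos)] @ v) (u @ v)"
| relator: "r \<in> R \<Longrightarrow> presentation_eq S R (u @ r @ v) (u @ v)"

text \<open>\<open>W\<close> is generated by \<open>S\<close>, and the kernel of the canonical map from the free group on \<open>S\<close>
  to \<open>W\<close> is the normal closure of the relators, i.e. \<open>W = \<langle>S | R\<rangle>\<close>.\<close>

definition has_presentation ::
  "('a, 'b) monoid_scheme \<Rightarrow> 'a set \<Rightarrow> 'a signed_word set \<Rightarrow> bool" where
  "has_presentation W S R \<longleftrightarrow>
     S \<subseteq> carrier W \<and> generate W S = carrier W \<and> R \<subseteq> lists (S \<times> UNIV) \<and>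
     (\<forall>w \<in> lists (S \<times> UNIV). eval_signed_word W w = \<one>\<^bsub>W\<^esub> \<longleftrightarrow> presentation_eq S R w [])"

text \<open>The entry \<open>0\<close> of a Coxeter matrix encodes \<open>\<infinity>\<close>; the corresponding relator is the empty word
  and imposes no relation.\<close>

definition coxeter_matrix :: "'a set \<Rightarrow> ('a \<Rightarrow> 'a \<Rightarrow> nat) \<Rightarrow> bool" where
  "coxeter_matrix S m \<longleftrightarrow>
     (\<forall>s\<in>S. m s s = 1) \<and>
     (\<forall>s\<in>S. \<forall>t\<in>S. m s t = m t s) \<and>
     (\<forall>s\<in>S. \<forall>t\<in>S. s \<noteq> t \<longrightarrow> m s t = 0 \<or> m s t \<ge> 2)"

definition coxeter_relators :: "'a set \<Rightarrow> ('a \<Rightarrow> 'a \<Rightarrow> nat) \<Rightarrow> 'a signed_word set" where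
  "coxeter_relators S m =
     {concat (replicate (m s t) [(s, True), (t, True)]) | s t. s \<in> S \<and> t \<in> S}"

definition coxeter_system :: "('a, 'b) monoid_scheme \<Rightarrow> 'a set \<Rightarrow> bool" where
  "coxeter_system W S \<longleftrightarrow>
     group W \<and> (\<exists>m. coxeter_matrix S m \<and> has_presentation W S (coxeter_relators S m))"

definition word_prod :: "('a, 'b) monoid_scheme \<Rightarrow> 'a list \<Rightarrow> 'a" where
  "word_prod W ws = foldr (\<lambda>s g. s \<otimes>\<^bsub>W\<^esub> g) ws \<one>\<^bsub>W\<^esub>"

definition coxeter_length :: "('a, 'b) monoid_scheme \<Rightarrow> 'a set \<Rightarrow> 'a \<Rightarrow> nat" where
  "coxeter_length W S g = (LEAST k. \<exists>ws. set ws \<subseteq> S \<and> word_prod W ws = g \<and> length ws = k)"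

definition reduced_expression ::
  "('a, 'b) monoid_scheme \<Rightarrow> 'a set \<Rightarrow> 'a list \<Rightarrow> 'a \<Rightarrow> bool" where
  "reduced_expression W S ws g \<longleftrightarrow>
     set ws \<subseteq> S \<and> word_prod W ws = g \<and> length ws = coxeter_length W S g"


section \<open>Subword complexes\<close>

text \<open>Positions in a word are counted from \<open>1\<close>, list indices from \<open>0\<close>.\<close>

definition subword :: "'a list \<Rightarrow> nat set \<Rightarrow> 'a list" where
  "subword Q P = nths Q {i. Suc i \<in> P}"

definition represents ::
  "('a, 'b) monoid_scheme \<Rightarrow> 'a set \<Rightarrow> 'a list \<Rightarrow> nat set \<Rightarrow> 'a \<Rightarrow> bool" where
  "represents W S Q P g \<longleftrightarrow> P \<subseteq> {1..length Q} \<and> reduced_expression W S (subword Q P) g"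

definition contains ::
  "('a, 'b) monoid_scheme \<Rightarrow> 'a set \<Rightarrow> 'a list \<Rightarrow> nat set \<Rightarrow> 'a \<Rightarrow> bool" where
  "contains W S Q P g \<longleftrightarrow> P \<subseteq> {1..length Q} \<and> (\<exists>P' \<subseteq> P. represents W S Q P' g)"

definition subword_complex ::
  "('a, 'b) monoid_scheme \<Rightarrow> 'a set \<Rightarrow> 'a list \<Rightarrow> 'a \<Rightarrow> nat set set" where
  "subword_complex W S Q g = {{1..length Q} - P | P. contains W S Q P g}"

definition facets :: "nat set set \<Rightarrow> nat set set" where
  "facets \<Delta> = {F \<in> \<Delta>. \<forall>F' \<in> \<Delta>. F \<subseteq> F' \<longrightarrow> F' = F}"

definition alexander_dual :: "nat \<Rightarrow> nat set set \<Rightarrow> nat set set" where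
  "alexander_dual n \<Delta> = {{1..n} - F | F. F \<subseteq> {1..n} \<and> F \<notin> \<Delta>}"


section \<open>Monomials, polynomials and monomial ideals\<close>

text \<open>A monomial is the multiset of its variable indices, so that divisibility, gcd and exact
  division of monomials are \<open>\<subseteq>#\<close>, \<open>\<inter>#\<close> and \<open>-\<close> on multisets, and the variable \<open>x\<^sub>l\<close> is
  \<open>{#l#}\<close>. For a finite set \<open>P\<close> the squarefree monomial \<open>x\<^sub>P\<close> is \<open>mset_set P\<close>.\<close>

type_synonym monomial = "nat multiset"

definition monomials :: "nat \<Rightarrow> monomial set" where
  "monomials n = {u. set_mset u \<subseteq> {1..n}}"

definition monomial_poly :: "monomial \<Rightarrow> monomial \<Rightarrow>\<^sub>0 'k::field" where
  "monomial_poly u = Poly_Mapping.single u 1"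

text \<open>The ring \<open>k[x\<^sub>1, \<dots>, x\<^sub>n]\<close>.\<close>

definition mpoly_ring :: "nat \<Rightarrow> (monomial \<Rightarrow>\<^sub>0 'k::field) ring" where
  "mpoly_ring n =
     \<lparr> carrier = {p. Poly_Mapping.keys p \<subseteq> monomials n},
       monoid.mult = (*), one = 1, ring.zero = 0, add = (+) \<rparr>"

definition ideal_generated_by_monomials ::
  "nat \<Rightarrow> monomial set \<Rightarrow> (monomial \<Rightarrow>\<^sub>0 'k::field) set" where
  "ideal_generated_by_monomials n A = Idl\<^bsub>mpoly_ring n\<^esub> (monomial_poly ` A)"

definition stanley_reisner_ideal ::
  "nat \<Rightarrow> nat set set \<Rightarrow> (monomial \<Rightarrow>\<^sub>0 'k::field) set" where
  "stanley_reisner_ideal n \<Delta> =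
     ideal_generated_by_monomials n {mset_set F | F. F \<subseteq> {1..n} \<and> F \<notin> \<Delta>}"

definition is_minimal_monomial_generating_set ::
  "nat \<Rightarrow> (monomial \<Rightarrow>\<^sub>0 'k::field) set \<Rightarrow> monomial set \<Rightarrow> bool" where
  "is_minimal_monomial_generating_set n I A \<longleftrightarrow>
     A \<subseteq> monomials n \<and> ideal_generated_by_monomials n A = I \<and>
     (\<forall>B \<subset> A. ideal_generated_by_monomials n B \<noteq> I)"

definition minimal_generators ::
  "nat \<Rightarrow> (monomial \<Rightarrow>\<^sub>0 'k::field) set \<Rightarrow> monomial set" where
  "minimal_generators n I = (THE A. is_minimal_monomial_generating_set n I A)"

text \<open>Lexicographical order with \<open>x\<^sub>1 > x\<^sub>2 > \<dots>\<close>: the leftmost differing exponent decides.\<close>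

definition lex_greater :: "monomial \<Rightarrow> monomial \<Rightarrow> bool" where
  "lex_greater u v \<longleftrightarrow> (\<exists>i. count v i < count u i \<and> (\<forall>j<i. count u j = count v j))"

definition has_linear_quotients ::
  "nat \<Rightarrow> (monomial \<Rightarrow>\<^sub>0 'k::field) set \<Rightarrow> monomial list \<Rightarrow> bool" where
  "has_linear_quotients n I us \<longleftrightarrow>
     is_minimal_monomial_generating_set n I (set us) \<and> distinct us \<and>
     (\<forall>i < length us. \<forall>j < i. \<exists>l \<in> {1..n}. \<exists>k < i.
        us ! k - (us ! i \<inter># us ! k) = {#l#} \<and>
        {#l#} \<subseteq># us ! j - (us ! i \<inter># us ! j))"


section \<open>The ideal of the Alexander dual of a subword complex\<close>

lemma mset_set_monomials: "F \<subseteq> {1..n} \<Longrightarrow> mset_set F \<in> monomials n"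
  using finite_subset[of F "{1..n}"] by (auto simp: monomials_def)

lemma monomials_add: "u \<in> monomials n \<Longrightarrow> v \<in> monomials n \<Longrightarrow> u + v \<in> monomials n"
  by (auto simp: monomials_def)

lemma cring_mpoly_ring: "cring (mpoly_ring n :: (monomial \<Rightarrow>\<^sub>0 'k::field) ring)"
proof -
  have mult: "Poly_Mapping.keys (p * q) \<subseteq> monomials n"
    if "Poly_Mapping.keys p \<subseteq> monomials n" "Poly_Mapping.keys q \<subseteq> monomials n"
    for p q :: "monomial \<Rightarrow>\<^sub>0 'k"
  proof
    fix u assume "u \<in> Poly_Mapping.keys (p * q)"
    then obtain a b where "a \<in> Poly_Mapping.keys p" "b \<in> Poly_Mapping.keys q" "u = a + b"
      using keys_mult[of p q] by auto
    with that show "u \<in> monomials n"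
      by (auto intro: monomials_add)
  qed
  have add: "Poly_Mapping.keys (p + q) \<subseteq> monomials n"
    if "Poly_Mapping.keys p \<subseteq> monomials n" "Poly_Mapping.keys q \<subseteq> monomials n"
    for p q :: "monomial \<Rightarrow>\<^sub>0 'k"
    using that Poly_Mapping.keys_add[of p q] by auto
  have one: "Poly_Mapping.keys (1 :: monomial \<Rightarrow>\<^sub>0 'k) \<subseteq> monomials n"
    by (simp add: monomials_def)
  have neg: "\<exists>q. Poly_Mapping.keys q \<subseteq> monomials n \<and> p + q = 0"
    if "Poly_Mapping.keys p \<subseteq> monomials n" for p :: "monomial \<Rightarrow>\<^sub>0 'k"
    using that by (intro exI[of _ "- p"]) (simp add: Poly_Mapping.keys_def)
  show ?thesis
  proof (rule cringI)
    show "abelian_group (mpoly_ring n :: (monomial \<Rightarrow>\<^sub>0 'k) ring)"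
      by (rule abelian_groupI) (auto simp: mpoly_ring_def add.assoc add.commute
            dest: add neg intro: subsetD[OF add])
    show "Group.comm_monoid (mpoly_ring n :: (monomial \<Rightarrow>\<^sub>0 'k) ring)"
      by (rule comm_monoidI) (auto simp: mpoly_ring_def mult.assoc mult.commute
            intro: subsetD[OF mult] subsetD[OF one])
  qed (auto simp: mpoly_ring_def distrib_right)
qed

lemma monomial_poly_carrier:
  "u \<in> monomials n \<Longrightarrow> (monomial_poly u :: monomial \<Rightarrow>\<^sub>0 'k::field) \<in> carrier (mpoly_ring n)"
  by (simp add: monomial_poly_def mpoly_ring_def)

lemma monomial_poly_in_ideal_iff:
  assumes "A \<subseteq> monomials n" "u \<in> monomials n"
  shows "(monomial_poly u :: monomial \<Rightarrow>\<^sub>0 'k::field) \<in> ideal_generated_by_monomials n A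
           \<longleftrightarrow> (\<exists>a\<in>A. a \<subseteq># u)"
proof -
  have neg: "Poly_Mapping.keys (- p) = Poly_Mapping.keys p" for p :: "monomial \<Rightarrow>\<^sub>0 'k"
    by (simp add: Poly_Mapping.keys_def)
  let ?R = "mpoly_ring n :: (monomial \<Rightarrow>\<^sub>0 'k) ring"
  let ?I = "ideal_generated_by_monomials n A :: (monomial \<Rightarrow>\<^sub>0 'k) set"
  let ?J = "{p \<in> carrier ?R. \<forall>m \<in> Poly_Mapping.keys p. \<exists>a\<in>A. a \<subseteq># m}"
  interpret R: cring ?R by (rule cring_mpoly_ring)
  have sub: "(monomial_poly ` A :: (monomial \<Rightarrow>\<^sub>0 'k) set) \<subseteq> carrier ?R"
    using assms monomial_poly_carrier by blast
  interpret I: ideal ?I ?R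
    unfolding ideal_generated_by_monomials_def by (rule R.genideal_ideal[OF sub])
  have absorb: "\<exists>a\<in>A. a \<subseteq># m"
    if p: "p \<in> ?J" and m: "m \<in> Poly_Mapping.keys (p * q)" for p q :: "monomial \<Rightarrow>\<^sub>0 'k" and m
  proof -
    obtain b c where bc: "b \<in> Poly_Mapping.keys p" "m = b + c"
      using m keys_mult[of p q] by auto
    then obtain a where "a \<in> A" "a \<subseteq># b" using p by auto
    then show ?thesis using bc by (metis mset_subset_eq_add_left subset_mset.order_trans)
  qed
  have "ideal ?J ?R"
  proof (rule idealI)
    show "ring ?R" by (rule R.ring_axioms)
    show "subgroup ?J (add_monoid ?R)"
    proof (rule R.add.subgroupI)
      show "?J \<noteq> {}"
        using R.zero_closed by (auto simp: mpoly_ring_def intro!: exI[of _ 0])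
      fix p assume p: "p \<in> ?J"
      then have "\<ominus>\<^bsub>?R\<^esub> p = - p"
        by (intro R.minus_equality) (auto simp: mpoly_ring_def neg)
      then show "\<ominus>\<^bsub>?R\<^esub> p \<in> ?J" using p by (auto simp: mpoly_ring_def neg)
    next
      fix p q assume pq: "p \<in> ?J" "q \<in> ?J"
      then have "p \<oplus>\<^bsub>?R\<^esub> q \<in> carrier ?R" by auto
      moreover have "p \<oplus>\<^bsub>?R\<^esub> q = p + q" by (simp add: mpoly_ring_def)
      ultimately show "p \<oplus>\<^bsub>?R\<^esub> q \<in> ?J"
        using pq Poly_Mapping.keys_add[of p q] by auto
    qed auto
    fix p x assume p: "p \<in> ?J" and x: "x \<in> carrier ?R"
    have *: "x \<otimes>\<^bsub>?R\<^esub> p = p * x" "p \<otimes>\<^bsub>?R\<^esub> x = p * x"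
      by (simp_all add: mpoly_ring_def mult.commute)
    show "p \<otimes>\<^bsub>?R\<^esub> x \<in> ?J" "x \<otimes>\<^bsub>?R\<^esub> p \<in> ?J"
      using R.m_closed[of p x] R.m_closed[of x p] p x absorb[OF p] unfolding * by auto
  qed
  moreover have "monomial_poly ` A \<subseteq> ?J"
    using sub by (auto simp: monomial_poly_def)
  ultimately have IJ: "?I \<subseteq> ?J"
    unfolding ideal_generated_by_monomials_def by (rule R.genideal_minimal)
  show ?thesis
  proof
    assume "(monomial_poly u :: monomial \<Rightarrow>\<^sub>0 'k) \<in> ?I"
    then show "\<exists>a\<in>A. a \<subseteq># u" using IJ by (auto simp: monomial_poly_def)
  next
    assume "\<exists>a\<in>A. a \<subseteq># u"
    then obtain a where a: "a \<in> A" "a \<subseteq># u" by auto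
    then have "u - a \<in> monomials n"
      using assms(2) by (auto simp: monomials_def dest: in_diffD)
    then have "monomial_poly a \<otimes>\<^bsub>?R\<^esub> monomial_poly (u - a) \<in> ?I"
      using a(1) R.genideal_self[OF sub]
      by (intro I.I_r_closed monomial_poly_carrier)
         (auto simp: ideal_generated_by_monomials_def)
    moreover have "monomial_poly a \<otimes>\<^bsub>?R\<^esub> monomial_poly (u - a) = monomial_poly u"
      using a(2) by (simp add: mpoly_ring_def monomial_poly_def mult_single)
    ultimately show "(monomial_poly u :: monomial \<Rightarrow>\<^sub>0 'k) \<in> ?I" by simp
  qed
qed

lemma ideal_generated_by_monomials_mono:
  assumes "A \<subseteq> monomials n" "B \<subseteq> monomials n" "\<forall>a\<in>A. \<exists>b\<in>B. b \<subseteq># a"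
  shows "(ideal_generated_by_monomials n A :: (monomial \<Rightarrow>\<^sub>0 'k::field) set)
           \<subseteq> ideal_generated_by_monomials n B"
proof -
  interpret R: cring "mpoly_ring n :: (monomial \<Rightarrow>\<^sub>0 'k) ring" by (rule cring_mpoly_ring)
  have "(monomial_poly ` A :: (monomial \<Rightarrow>\<^sub>0 'k) set) \<subseteq> ideal_generated_by_monomials n B"
    using assms monomial_poly_in_ideal_iff[OF assms(2), where 'k = 'k] by blast
  moreover have "ideal (ideal_generated_by_monomials n B :: (monomial \<Rightarrow>\<^sub>0 'k) set) (mpoly_ring n)"
    unfolding ideal_generated_by_monomials_def
    using assms(2) by (intro R.genideal_ideal) (auto intro: monomial_poly_carrier)
  ultimately show ?thesis
    unfolding ideal_generated_by_monomials_def[of n A] by (intro R.genideal_minimal)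
qed

lemma is_minimal_monomial_generating_set_antichain_iff:
  assumes A: "A \<subseteq> monomials n" and anti: "\<forall>a\<in>A. \<forall>b\<in>A. a \<subseteq># b \<longrightarrow> a = b"
    and I: "I = (ideal_generated_by_monomials n A :: (monomial \<Rightarrow>\<^sub>0 'k::field) set)"
  shows "is_minimal_monomial_generating_set n I B \<longleftrightarrow> B = A"
proof
  assume B: "is_minimal_monomial_generating_set n I B"
  have BI: "ideal_generated_by_monomials n B = I" and Bn: "B \<subseteq> monomials n"
    using B by (auto simp: is_minimal_monomial_generating_set_def)
  have "A \<subseteq> B"
  proof
    fix a assume a: "a \<in> A"
    then have "(monomial_poly a :: monomial \<Rightarrow>\<^sub>0 'k) \<in> I"
      using monomial_poly_in_ideal_iff[OF A, of a, where 'k = 'k] A I by auto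
    then obtain b where b: "b \<in> B" "b \<subseteq># a"
      using monomial_poly_in_ideal_iff[OF Bn, of a, where 'k = 'k] a A BI by auto
    then have "(monomial_poly b :: monomial \<Rightarrow>\<^sub>0 'k) \<in> I"
      using monomial_poly_in_ideal_iff[OF Bn, of b, where 'k = 'k] Bn BI by auto
    then obtain a' where "a' \<in> A" "a' \<subseteq># b"
      using monomial_poly_in_ideal_iff[OF A, of b, where 'k = 'k] b(1) Bn I by auto
    then show "a \<in> B"
      using a b anti by (metis subset_mset.order_antisym subset_mset.order_trans)
  qed
  then show "B = A"
    using B I unfolding is_minimal_monomial_generating_set_def by blast
next
  assume "B = A"
  moreover have "ideal_generated_by_monomials n C \<noteq> I" if C: "C \<subset> A" for C
  proof
    assume CI: "ideal_generated_by_monomials n C = I"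
    obtain a where a: "a \<in> A" "a \<notin> C" using C by auto
    have "(monomial_poly a :: monomial \<Rightarrow>\<^sub>0 'k) \<in> I"
      using monomial_poly_in_ideal_iff[OF A, of a, where 'k = 'k] a A I by auto
    then obtain c where "c \<in> C" "c \<subseteq># a"
      using monomial_poly_in_ideal_iff[of C n a, where 'k = 'k] a C A CI by auto
    then show False using a C anti by auto
  qed
  ultimately show "is_minimal_monomial_generating_set n I B"
    using A I by (auto simp: is_minimal_monomial_generating_set_def)
qed

lemma stanley_reisner_ideal_alexander_dual:
  assumes "\<forall>F\<in>\<Delta>. F \<subseteq> {1..n}"
  shows "(stanley_reisner_ideal n (alexander_dual n \<Delta>) :: (monomial \<Rightarrow>\<^sub>0 'k::field) set) =
         ideal_generated_by_monomials n {mset_set ({1..n} - F) | F. F \<in> facets \<Delta>}"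
    (is "_ = ideal_generated_by_monomials n ?B")
proof -
  let ?A = "{mset_set F | F. F \<subseteq> {1..n} \<and> F \<notin> alexander_dual n \<Delta>}"
  have in_dual: "{1..n} - F \<in> alexander_dual n \<Delta> \<longleftrightarrow> F \<notin> \<Delta>" if "F \<subseteq> {1..n}" for F
    using that unfolding alexander_dual_def
    by (auto simp: double_diff) (metis double_diff subset_refl)
  have An: "?A \<subseteq> monomials n" and Bn: "?B \<subseteq> monomials n"
    by (auto intro!: mset_set_monomials)
  have "\<forall>b\<in>?B. \<exists>a\<in>?A. a \<subseteq># b"
  proof
    fix b assume "b \<in> ?B"
    then obtain F where F: "b = mset_set ({1..n} - F)" "F \<in> \<Delta>"
      by (auto simp: facets_def)
    then have "{1..n} - F \<notin> alexander_dual n \<Delta>"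
      using in_dual[of F] assms by blast
    then have "b \<in> ?A" using F(1) by blast
    then show "\<exists>a\<in>?A. a \<subseteq># b" by (rule bexI[rotated]) simp
  qed
  moreover have "\<forall>a\<in>?A. \<exists>b\<in>?B. b \<subseteq># a"
  proof
    fix a assume a: "a \<in> ?A"
    obtain F where F: "a = mset_set F" "F \<subseteq> {1..n}" "F \<notin> alexander_dual n \<Delta>"
      using a by auto
    then have 1: "{1..n} - F \<in> \<Delta>"
      using in_dual[of "{1..n} - F"] by (auto simp: double_diff)
    have fin: "finite \<Delta>"
      using assms by (meson Pow_iff finite_Pow_iff finite_atLeastAtMost finite_subset subsetI)
    obtain G where G: "G \<in> \<Delta>" "{1..n} - F \<subseteq> G" "\<forall>G'\<in>\<Delta>. G \<subseteq> G' \<longrightarrow> G' = G"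
      using finite_has_maximal2[OF fin 1] by metis
    have "{1..n} - G \<subseteq> F" using G(2) by auto
    moreover have "finite F" using F(2) finite_subset by blast
    ultimately have "mset_set ({1..n} - G) \<subseteq># a"
      using F(1) by (simp add: subset_imp_msubset_mset_set)
    moreover have "G \<in> facets \<Delta>" using G by (auto simp: facets_def)
    ultimately show "\<exists>b\<in>?B. b \<subseteq># a" by blast
  qed
  ultimately show ?thesis
    unfolding stanley_reisner_ideal_def
    by (intro subset_antisym ideal_generated_by_monomials_mono An Bn)
qed

lemma card_represents:
  assumes "represents W S Q P g"
  shows "card P = coxeter_length W S g"
proof -
  have P: "P \<subseteq> {1..length Q}" using assms by (simp add: represents_def)
  have "P = Suc ` {i. i < length Q \<and> i \<in> {i. Suc i \<in> P}}"
  proof (rule Set.set_eqI)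
    fix x show "x \<in> P \<longleftrightarrow> x \<in> Suc ` {i. i < length Q \<and> i \<in> {i. Suc i \<in> P}}"
      using P by (cases x) auto
  qed
  then have "card P = length (subword Q P)"
    unfolding subword_def length_nths by (metis (no_types, lifting) card_image inj_Suc)
  then show ?thesis using assms by (simp add: represents_def reduced_expression_def)
qed

lemma facets_subword_complex:
  "facets (subword_complex W S Q g) = {{1..length Q} - P | P. represents W S Q P g}"
proof -
  let ?N = "{1..length Q}"
  have rc: "contains W S Q P g" if "represents W S Q P g" for P
    using that by (auto simp: contains_def represents_def)
  have fin: "finite P" if "represents W S Q P g" for P
    using that finite_subset by (auto simp: represents_def)
  show ?thesis
  proof (intro Set.set_eqI iffI)
    fix F assume F: "F \<in> facets (subword_complex W S Q g)"
    then obtain P where P: "F = ?N - P" "contains W S Q P g"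
      by (auto simp: facets_def subword_complex_def)
    then obtain P' where P': "P' \<subseteq> P" "represents W S Q P' g"
      by (auto simp: contains_def)
    then have "?N - P' \<in> subword_complex W S Q g"
      using rc by (auto simp: subword_complex_def)
    moreover have "F \<subseteq> ?N - P'" using P(1) P'(1) by auto
    ultimately have "?N - P' = F" using F by (auto simp: facets_def)
    then show "F \<in> {?N - P | P. represents W S Q P g}" using P' by auto
  next
    fix F assume "F \<in> {?N - P | P. represents W S Q P g}"
    then obtain P where P: "F = ?N - P" "represents W S Q P g" by auto
    have "F' = F" if F': "F' \<in> subword_complex W S Q g" "F \<subseteq> F'" for F'
    proof -
      obtain P2 where P2: "F' = ?N - P2" "contains W S Q P2 g"
        using F' by (auto simp: subword_complex_def)
      then obtain P3 where P3: "P3 \<subseteq> P2" "represents W S Q P3 g" "P2 \<subseteq> ?N"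
        by (auto simp: contains_def)
      have "P2 \<subseteq> P" using F'(2) P(1) P2(1) P3(3) by auto
      moreover have "P3 = P"
        using card_subset_eq[OF fin[OF P(2)], of P3] card_represents[OF P(2)]
          card_represents[OF P3(2)] calculation P3(1) by auto
      ultimately show ?thesis using P P2 P3 by auto
    qed
    then show "F \<in> facets (subword_complex W S Q g)"
      using P rc by (auto simp: facets_def subword_complex_def)
  qed
qed

lemma stanley_reisner_ideal_dual_subword_complex:
  "(stanley_reisner_ideal (length Q) (alexander_dual (length Q) (subword_complex W S Q g))
     :: (monomial \<Rightarrow>\<^sub>0 'k::field) set) =
   ideal_generated_by_monomials (length Q) {mset_set P | P. represents W S Q P g}"
proof -
  have "{mset_set ({1..length Q} - F) | F. F \<in> facets (subword_complex W S Q g)} =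
        {mset_set P | P. represents W S Q P g}"
    unfolding facets_subword_complex
    by (auto simp: represents_def double_diff) (metis double_diff subset_refl)
  then show ?thesis
    by (subst stanley_reisner_ideal_alexander_dual) (auto simp: subword_complex_def)
qed

lemma minimal_generators_dual_subword_complex:
  "minimal_generators (length Q)
     (stanley_reisner_ideal (length Q) (alexander_dual (length Q) (subword_complex W S Q g))
        :: (monomial \<Rightarrow>\<^sub>0 'k::field) set) =
   {mset_set P | P. represents W S Q P g}"
proof -
  let ?A = "{mset_set P | P. represents W S Q P g}"
  have fin: "finite P" if "represents W S Q P g" for P
    using that finite_subset by (auto simp: represents_def)
  have "?A \<subseteq> monomials (length Q)"
    using mset_set_monomials by (auto simp: represents_def)
  moreover have "\<forall>a\<in>?A. \<forall>b\<in>?A. a \<subseteq># b \<longrightarrow> a = b"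
  proof (intro ballI impI)
    fix a b assume ab: "a \<in> ?A" "b \<in> ?A" "a \<subseteq># b"
    then obtain P P' where P: "a = mset_set P" "represents W S Q P g"
      and P': "b = mset_set P'" "represents W S Q P' g" by auto
    have "P \<subseteq> P'" using ab(3) P P' fin by (metis msubset_mset_set_iff)
    then show "a = b"
      using card_subset_eq[OF fin[OF P'(2)], of P] card_represents[OF P(2)]
        card_represents[OF P'(2)] P P' by auto
  qed
  ultimately have "is_minimal_monomial_generating_set (length Q)
      (stanley_reisner_ideal (length Q) (alexander_dual (length Q) (subword_complex W S Q g))
        :: (monomial \<Rightarrow>\<^sub>0 'k) set) B \<longleftrightarrow> B = ?A" for B
    by (rule is_minimal_monomial_generating_set_antichain_iff
          [OF _ _ stanley_reisner_ideal_dual_subword_complex])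
  then show ?thesis
    unfolding minimal_generators_def by (intro the_equality) auto
qed

end

theory Submission
  imports Defs
begin

text \<open>
  Write \<open>u\<^sub>i = x\<^sub>B\<close> and \<open>u\<^sub>j = x\<^sub>A\<close> with \<open>j < i\<close>, so that \<open>x\<^sub>A\<close> is lexicographically greater than
  \<open>x\<^sub>B\<close>, and let \<open>l\<close> be the least position at which \<open>A\<close> and \<open>B\<close> differ; then \<open>l \<in> A\<close> and \<open>l \<notin> B\<close>.
  The subwords at \<open>A\<close> and \<open>B\<close> are \<open>c, \<sigma>\<^sub>l, v\<close> and \<open>c, b\<close> with the same beginning \<open>c\<close>, and both are
  reduced expressions for \<open>g\<close>. The exchange property of Coxeter groups says that \<open>\<sigma>\<^sub>l\<close> can be put in
  front of \<open>b\<close> if a suitable letter of \<open>b\<close> is deleted: for some position \<open>m \<in> B\<close> with \<open>m > l\<close>, the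
  set \<open>B' = B - {m} \<union> {l}\<close> represents \<open>g\<close> as well. Since \<open>l < m\<close>, the monomial \<open>x\<^bsub>B'\<^esub>\<close> precedes
  \<open>x\<^sub>B\<close>, and \<open>B' - B = {l} \<subseteq> A - B\<close>. This is the condition for linear quotients
  (\<open>exchange_represents\<close>).

  The exchange property is derived from the presentation. A word \<open>s\<^sub>1 \<dots> s\<^sub>k\<close> determines the
  reflections \<open>s\<^sub>1 \<dots> s\<^sub>i \<dots> s\<^sub>1\<close> for \<open>i \<le> k\<close>. Multiplying the product of the word on the left by
  the \<open>i\<close>-th one deletes the \<open>i\<close>-th letter. Which reflections occur an odd number of times depends
  only on the product of the word (\<open>odd_reflection_cong\<close>), because no reflection does so in a
  relator: the list of \<open>(st)\<^sup>m\<close> consists of \<open>m\<close> reflections repeated twice. In a reduced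
  expression that begins with \<open>s\<close>, the reflection \<open>s\<close> occurs once, hence it occurs in every other
  word for the same element, and left multiplication by \<open>s\<close> deletes a letter of that word
  (\<open>exchange_after_prefix\<close>).
\<close>

section \<open>Words in involutions\<close>

lemma word_prod_Nil [simp]: "word_prod G [] = \<one>\<^bsub>G\<^esub>"
  by (simp add: word_prod_def)

lemma word_prod_Cons [simp]: "word_prod G (s # ws) = s \<otimes>\<^bsub>G\<^esub> word_prod G ws"
  by (simp add: word_prod_def)

lemma eval_signed_word_positive:
  "eval_signed_word G (map (\<lambda>s. (s, True)) ws) = word_prod G ws"
  by (induction ws) (auto simp: eval_signed_word_def)

text \<open>The reflections of \<open>s # ws\<close> are \<open>s\<close> and the conjugates by \<open>s\<close> of those of \<open>ws\<close>. Hence, for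
  involutions \<open>s\<close>, the following says that \<open>x\<close> occurs an odd number of times among the elements
  \<open>s\<^sub>1 \<dots> s\<^sub>i \<dots> s\<^sub>1\<close> for the prefixes \<open>s\<^sub>1 \<dots> s\<^sub>i\<close> of the word.\<close>

primrec odd_reflection :: "('a, 'b) monoid_scheme \<Rightarrow> 'a list \<Rightarrow> 'a \<Rightarrow> bool" where
  "odd_reflection G [] x \<longleftrightarrow> False"
| "odd_reflection G (s # ws) x \<longleftrightarrow> (x = s) \<noteq> odd_reflection G ws (s \<otimes>\<^bsub>G\<^esub> x \<otimes>\<^bsub>G\<^esub> s)"

locale involution_words = group G for G (structure) +
  fixes S :: "'a set"
  assumes S_carrier: "S \<subseteq> carrier G"
    and involution: "s \<in> S \<Longrightarrow> s \<otimes> s = \<one>"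
begin

lemma S_closed: "s \<in> S \<Longrightarrow> s \<in> carrier G"
  using S_carrier by auto

lemma involution_cancel: "s \<in> S \<Longrightarrow> x \<in> carrier G \<Longrightarrow> s \<otimes> (s \<otimes> x) = x"
  using involution S_closed by (metis l_one m_assoc)

lemma word_prod_closed: "set ws \<subseteq> S \<Longrightarrow> word_prod G ws \<in> carrier G"
  by (induction ws) (auto intro: S_closed)

lemma word_prod_append:
  "set us \<subseteq> S \<Longrightarrow> set vs \<subseteq> S \<Longrightarrow> word_prod G (us @ vs) = word_prod G us \<otimes> word_prod G vs"
  by (induction us) (auto simp: word_prod_closed S_closed m_assoc)

lemma word_prod_rev: "set ws \<subseteq> S \<Longrightarrow> word_prod G (rev ws) = inv (word_prod G ws)"
proof (induction ws)
  case (Cons s ws)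
  then have "inv s = s" by (simp add: S_closed involution inv_equality)
  with Cons show ?case
    by (simp add: word_prod_append word_prod_closed S_closed inv_mult_group)
qed simp

lemma odd_reflection_append:
  assumes "set us \<subseteq> S" "set vs \<subseteq> S" "x \<in> carrier G"
  shows "odd_reflection G (us @ vs) x \<longleftrightarrow>
    odd_reflection G us x \<noteq> odd_reflection G vs (inv (word_prod G us) \<otimes> x \<otimes> word_prod G us)"
  using assms
proof (induction us arbitrary: x)
  case (Cons s us)
  then have s: "s \<in> S" "inv s = s" by (auto simp: S_closed involution inv_equality)
  have "inv (word_prod G (s # us)) \<otimes> x \<otimes> word_prod G (s # us)
      = inv (word_prod G us) \<otimes> (s \<otimes> x \<otimes> s) \<otimes> word_prod G us"
    using Cons.prems s by (simp add: inv_mult_group word_prod_closed S_closed m_assoc)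
  then show ?case
    using Cons.IH[of "s \<otimes> x \<otimes> s"] Cons.prems by (auto simp: S_closed)
qed simp

text \<open>For \<open>x = s\<^sub>1 \<dots> s\<^sub>i \<dots> s\<^sub>1\<close>, the product \<open>x s\<^sub>1 \<dots> s\<^sub>i\<close> collapses to the product of the first
  \<open>i - 1\<close> letters. An element with odd parity has this form for at least one \<open>i\<close>.\<close>

lemma odd_reflection_deletion:
  assumes "set ws \<subseteq> S" "x \<in> carrier G" "odd_reflection G ws x"
  shows "\<exists>ys z zs. ws = ys @ z # zs \<and> x \<otimes> word_prod G ws = word_prod G (ys @ zs)"
  using assms
proof (induction ws arbitrary: x)
  case (Cons s ws)
  have s: "s \<in> S" "s \<in> carrier G" and ws: "word_prod G ws \<in> carrier G"
    using Cons.prems by (auto simp: S_closed word_prod_closed)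
  show ?case
  proof (cases "x = s")
    case True
    then have "x \<otimes> word_prod G (s # ws) = word_prod G ([] @ ws)"
      using s ws by (simp add: involution_cancel)
    then show ?thesis by blast
  next
    case False
    then obtain ys z zs where split: "ws = ys @ z # zs"
      and del: "s \<otimes> x \<otimes> s \<otimes> word_prod G ws = word_prod G (ys @ zs)"
      using Cons.IH[of "s \<otimes> x \<otimes> s"] Cons.prems s by auto
    have "x \<otimes> word_prod G (s # ws) = s \<otimes> (s \<otimes> x \<otimes> s \<otimes> word_prod G ws)"
      using Cons.prems(2) s ws by (simp add: m_assoc involution_cancel)
    then have "x \<otimes> word_prod G (s # ws) = word_prod G ((s # ys) @ zs)"
      using del by simp
    then show ?thesis using split by (metis append_Cons)
  qed
qed simp

text \<open>The reflections of the word \<open>(st)\<^sup>k\<close> are \<open>(st)\<^sup>j s\<close> for \<open>j < 2k\<close>: the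
  first two letters give \<open>s\<close> and \<open>sts\<close>, and conjugation by \<open>st\<close> takes \<open>(st)\<^sup>j s\<close> to
  \<open>(st)\<^bsup>j+2\<^esup> s\<close>.\<close>

lemma odd_reflection_dihedral:
  assumes s: "s \<in> S" and t: "t \<in> S" and x: "x \<in> carrier G"
  shows "odd_reflection G (concat (replicate k [s, t])) x \<longleftrightarrow>
    odd (card {j. j < 2 * k \<and> (s \<otimes> t) [^] j \<otimes> s = x})"
  using x
proof (induction k arbitrary: x)
  case (Suc k)
  have c: "s \<in> carrier G" "t \<in> carrier G" using s t by (auto simp: S_closed)
  let ?P = "\<lambda>x (j::nat). (s \<otimes> t) [^] j \<otimes> s = x"
  let ?y = "t \<otimes> (s \<otimes> x \<otimes> s) \<otimes> t"
  have conj: "?P ?y j \<longleftrightarrow> ?P x (Suc (Suc j))" for j :: nat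
  proof -
    define q where "q = (s \<otimes> t) [^] j \<otimes> s"
    have q: "q \<in> carrier G" using c by (simp add: q_def)
    have "(s \<otimes> t) [^] Suc (Suc j) = s \<otimes> t \<otimes> ((s \<otimes> t) [^] j \<otimes> (s \<otimes> t))"
      using c nat_pow_Suc2[of "s \<otimes> t" "Suc j"] by simp
    then have "(s \<otimes> t) [^] Suc (Suc j) \<otimes> s = s \<otimes> (t \<otimes> (q \<otimes> (t \<otimes> s)))"
      using c by (simp add: m_assoc q_def del: nat_pow_Suc)
    moreover have "q = ?y \<longleftrightarrow> s \<otimes> (t \<otimes> (q \<otimes> (t \<otimes> s))) = x"
    proof
      assume "q = ?y"
      then show "s \<otimes> (t \<otimes> (q \<otimes> (t \<otimes> s))) = x"
        using c s t Suc.prems by (simp add: m_assoc involution_cancel involution)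
    next
      assume "s \<otimes> (t \<otimes> (q \<otimes> (t \<otimes> s))) = x"
      from this [symmetric] show "q = ?y"
        using c s t q by (simp add: m_assoc involution_cancel involution)
    qed
    ultimately show ?thesis by (simp add: q_def)
  qed
  have "s \<otimes> x \<otimes> s = t \<longleftrightarrow> s \<otimes> t \<otimes> s = x"
    using c s Suc.prems
    by (metis involution_cancel involution m_assoc m_closed r_one)
  then have step: "odd_reflection G (concat (replicate (Suc k) [s, t])) x \<longleftrightarrow>
      ?P x 0 \<noteq> (?P x 1 \<noteq> odd (card {j. j < 2 * k \<and> ?P x (Suc (Suc j))}))"
    using Suc.IH[of ?y] Suc.prems c
    by (simp add: conj eq_commute[of x s] eq_commute[of _ t] del: nat_pow_Suc)
  have "{j. j < 2 * Suc k \<and> ?P x j} = {j. j = 0 \<and> ?P x 0} \<union> {j. j = 1 \<and> ?P x 1} \<union>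
      (\<lambda>j. Suc (Suc j)) ` {j. j < 2 * k \<and> ?P x (Suc (Suc j))}" (is "?L = ?A \<union> ?B \<union> ?C")
  proof (intro Set.set_eqI)
    fix j show "j \<in> ?L \<longleftrightarrow> j \<in> ?A \<union> ?B \<union> ?C"
      by (cases j rule: nat.exhaust; cases "j - 1") auto
  qed
  moreover have "card (?A \<union> ?B \<union> ?C) = card ?A + card ?B + card ?C"
    by (subst card_Un_disjoint; (subst card_Un_disjoint)?) auto
  moreover have "card ?C = card {j. j < 2 * k \<and> ?P x (Suc (Suc j))}"
    by (intro card_image) (auto simp: inj_on_def)
  moreover have "card ?A = of_bool (?P x 0)" "card ?B = of_bool (?P x 1)"
    by auto
  ultimately show ?case using step by simp
qed simp

lemma set_dihedral_word: "set (concat (replicate k [s, t])) \<subseteq> {s, t}"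
  by (induction k) auto

lemma word_prod_dihedral:
  assumes "s \<in> S" "t \<in> S"
  shows "word_prod G (concat (replicate k [s, t])) = (s \<otimes> t) [^] k"
proof (induction k)
  case (Suc k)
  then show ?case using assms nat_pow_Suc2[of "s \<otimes> t" k] by (simp add: S_closed m_assoc)
qed simp

text \<open>If \<open>(st)\<^sup>m = 1\<close>, then the elements \<open>(st)\<^sup>j s\<close> with \<open>j < m\<close> recur in the same order for
  \<open>m \<le> j < 2m\<close>.\<close>

lemma odd_reflection_dihedral_relator:
  assumes "s \<in> S" "t \<in> S" "x \<in> carrier G" "(s \<otimes> t) [^] m = \<one>"
  shows "\<not> odd_reflection G (concat (replicate m [s, t])) x"
proof -
  let ?P = "\<lambda>j::nat. (s \<otimes> t) [^] j \<otimes> s = x"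
  have "(s \<otimes> t) [^] (j + m) = (s \<otimes> t) [^] j" for j :: nat
    using assms by (simp add: S_closed flip: nat_pow_mult)
  then have per: "?P (j + m) \<longleftrightarrow> ?P j" for j by simp
  have "{j. j < 2 * m \<and> ?P j} = {j. j < m \<and> ?P j} \<union> (\<lambda>j. j + m) ` {j. j < m \<and> ?P j}"
    (is "?L = ?A \<union> ?B")
  proof (intro Set.set_eqI)
    fix j show "j \<in> ?L \<longleftrightarrow> j \<in> ?A \<union> ?B"
    proof (cases "j < m")
      case False
      then obtain i where "j = i + m" by (metis add.commute le_Suc_ex not_less)
      with False per[of i] show ?thesis by (simp add: image_iff)
    qed auto
  qed
  moreover have "card (?A \<union> ?B) = card ?A + card ?B"
    by (intro card_Un_disjoint) auto
  moreover have "card ?B = card ?A"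
    by (intro card_image) (auto simp: inj_on_def)
  ultimately show ?thesis using odd_reflection_dihedral[OF assms(1-3), of m] by simp
qed

end

section \<open>The exchange property\<close>

locale coxeter_words = involution_words +
  fixes m :: "'a \<Rightarrow> 'a \<Rightarrow> nat"
  assumes presentation: "has_presentation G S (coxeter_relators S m)"
begin

lemma coxeter_relator:
  assumes "s \<in> S" "t \<in> S"
  shows "(s \<otimes> t) [^] m s t = \<one>"
proof -
  let ?w = "concat (replicate (m s t) [s, t])"
  let ?r = "map (\<lambda>s. (s, True)) ?w"
  have "?r = concat (replicate (m s t) [(s, True), (t, True)])"
    by (simp add: map_concat)
  then have "?r \<in> coxeter_relators S m"
    using assms by (auto simp: coxeter_relators_def)
  then have "presentation_eq S (coxeter_relators S m) ?r []"
    using presentation_eq.relator[of ?r "coxeter_relators S m" S "[]" "[]"] by simp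
  moreover have "?r \<in> lists (S \<times> UNIV)"
    using assms set_dihedral_word[of "m s t" s t] by (auto simp del: set_concat)
  ultimately have "eval_signed_word G ?r = \<one>"
    using presentation by (auto simp: has_presentation_def)
  then show ?thesis
    using word_prod_dihedral[OF assms] by (simp only: eval_signed_word_positive)
qed

text \<open>Signs can be dropped because the letters are involutions. The rules of \<open>presentation_eq\<close> admit
  letters outside \<open>S\<close>; the first conjunct excludes them from a derivation between words over \<open>S\<close>.\<close>

lemma odd_reflection_presentation_eq:
  assumes "presentation_eq S (coxeter_relators S m) u v"
  shows "(set (map fst u) \<subseteq> S \<longleftrightarrow> set (map fst v) \<subseteq> S) \<and>
    (set (map fst u) \<subseteq> S \<longrightarrow>
      (\<forall>x \<in> carrier G. odd_reflection G (map fst u) x \<longleftrightarrow> odd_reflection G (map fst v) x))"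
proof -
  have insert: "odd_reflection G (us @ rs @ vs) x \<longleftrightarrow> odd_reflection G (us @ vs) x"
    if S: "set us \<subseteq> S" "set rs \<subseteq> S" "set vs \<subseteq> S" and x: "x \<in> carrier G"
      and "word_prod G rs = \<one>" "\<forall>x \<in> carrier G. \<not> odd_reflection G rs x"
    for us rs vs x
    using that odd_reflection_append[of us vs x] odd_reflection_append[of us "rs @ vs" x]
      odd_reflection_append[of rs vs "inv (word_prod G us) \<otimes> x \<otimes> word_prod G us"]
    by (simp add: word_prod_closed)
  show ?thesis
    using assms
  proof induction
    case (cancel s u pos v)
    have "odd_reflection G (map fst u @ [s, s] @ map fst v) x
        \<longleftrightarrow> odd_reflection G (map fst u @ map fst v) x"
      if "set (map fst u) \<subseteq> S" "set (map fst v) \<subseteq> S" "x \<in> carrier G" for x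
    proof (rule insert)
      show "word_prod G [s, s] = \<one>" using cancel by (simp add: S_closed involution)
      show "\<forall>x \<in> carrier G. \<not> odd_reflection G [s, s] x"
        using cancel odd_reflection_dihedral_relator[of s s _ 1]
        by (simp add: S_closed involution del: odd_reflection.simps)
    qed (use that cancel in auto)
    then show ?case using cancel by auto
  next
    case (relator r u v)
    then obtain s t where st: "s \<in> S" "t \<in> S"
      and r: "r = concat (replicate (m s t) [(s, True), (t, True)])"
      by (auto simp: coxeter_relators_def)
    have rw: "map fst r = concat (replicate (m s t) [s, t])"
      by (simp add: r map_concat)
    have rS: "set (map fst r) \<subseteq> S" unfolding rw using st set_dihedral_word[of "m s t" s t] by blast
    have "odd_reflection G (map fst u @ map fst r @ map fst v) x
        \<longleftrightarrow> odd_reflection G (map fst u @ map fst v) x"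
      if "set (map fst u) \<subseteq> S" "set (map fst v) \<subseteq> S" "x \<in> carrier G" for x
    proof (rule insert)
      show "word_prod G (map fst r) = \<one>"
        unfolding rw using st by (simp add: word_prod_dihedral coxeter_relator)
      show "\<forall>x \<in> carrier G. \<not> odd_reflection G (map fst r) x"
        unfolding rw using st by (simp add: odd_reflection_dihedral_relator coxeter_relator)
    qed (use that rS in auto)
    then show ?case using rS by auto
  qed auto
qed

lemma odd_reflection_trivial_word:
  assumes "set ws \<subseteq> S" "word_prod G ws = \<one>" "x \<in> carrier G"
  shows "\<not> odd_reflection G ws x"
proof -
  let ?w = "map (\<lambda>s. (s, True)) ws"
  have "?w \<in> lists (S \<times> UNIV)" using assms(1) by auto
  moreover have "eval_signed_word G ?w = \<one>"
    using assms(2) by (simp add: eval_signed_word_positive)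
  ultimately have "presentation_eq S (coxeter_relators S m) ?w []"
    using presentation by (auto simp: has_presentation_def)
  from odd_reflection_presentation_eq[OF this] assms show ?thesis
    by (simp add: comp_def)
qed

text \<open>Appending \<open>rev vs\<close> to \<open>us\<close> or to \<open>vs\<close> gives a word for the identity. Hence the parities of
  \<open>us\<close> and of \<open>vs\<close> at \<open>x\<close> both equal the parity of \<open>rev vs\<close> at the same conjugate of \<open>x\<close>.\<close>

lemma odd_reflection_cong:
  assumes us: "set us \<subseteq> S" and vs: "set vs \<subseteq> S" and eq: "word_prod G us = word_prod G vs"
    and x: "x \<in> carrier G"
  shows "odd_reflection G us x \<longleftrightarrow> odd_reflection G vs x"
proof -
  have triv: "\<not> odd_reflection G (ws @ rev vs) y"
    if "set ws \<subseteq> S" "word_prod G ws = word_prod G vs" "y \<in> carrier G" for ws y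
    using that vs
    by (intro odd_reflection_trivial_word) (auto simp: word_prod_append word_prod_rev word_prod_closed)
  have "odd_reflection G ws x \<longleftrightarrow>
      odd_reflection G (rev vs) (inv (word_prod G vs) \<otimes> x \<otimes> word_prod G vs)"
    if "set ws \<subseteq> S" "word_prod G ws = word_prod G vs" for ws
    using triv[OF that x] odd_reflection_append[OF that(1), of "rev vs" x] vs x that by simp
  from this[OF us eq] this[OF vs HOL.refl] show ?thesis by simp
qed

lemma coxeter_length_le:
  "set ws \<subseteq> S \<Longrightarrow> coxeter_length G S (word_prod G ws) \<le> length ws"
  unfolding coxeter_length_def by (rule Least_le) auto

text \<open>The common prefix \<open>cs\<close> cancels. In \<open>s # vs\<close>, the reflection \<open>s\<close> occurs at the first letter and
  an even number of times later: otherwise a letter of \<open>vs\<close> could be deleted together with \<open>s\<close>.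
  Hence it occurs in \<open>ws\<close>.\<close>

lemma exchange_after_prefix:
  assumes red: "reduced_expression G S (cs @ s # vs) g"
    and ws: "set (cs @ ws) \<subseteq> S" "word_prod G (cs @ ws) = g"
  shows "\<exists>ys z zs. ws = ys @ z # zs \<and> word_prod G (cs @ s # ys @ zs) = g"
proof -
  have S: "set cs \<subseteq> S" "s \<in> S" "set vs \<subseteq> S" "set ws \<subseteq> S"
    using red ws by (auto simp: reduced_expression_def)
  have closed: "word_prod G cs \<in> carrier G" "s \<in> carrier G" "word_prod G vs \<in> carrier G"
      "word_prod G ws \<in> carrier G"
    using S by (auto simp: S_closed word_prod_closed)
  have g: "word_prod G (cs @ s # vs) = g" "length (cs @ s # vs) = coxeter_length G S g"
    using red by (auto simp: reduced_expression_def)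
  have "word_prod G cs \<otimes> word_prod G ws = word_prod G cs \<otimes> word_prod G (s # vs)"
    using g ws(2) S by (simp add: word_prod_append)
  then have eq: "word_prod G ws = word_prod G (s # vs)"
    using closed by (metis l_cancel m_closed word_prod_Cons)
  have "\<not> odd_reflection G vs s"
  proof
    assume "odd_reflection G vs s"
    then obtain ys z zs where del: "vs = ys @ z # zs" "s \<otimes> word_prod G vs = word_prod G (ys @ zs)"
      using odd_reflection_deletion[of vs s] S closed by auto
    have "word_prod G (cs @ ys @ zs) = g"
      using del g(1) S word_prod_append[of cs "s # vs"] word_prod_append[of cs "ys @ zs"] by auto
    then have "coxeter_length G S g \<le> length (cs @ ys @ zs)"
      using coxeter_length_le[of "cs @ ys @ zs"] S del(1) by auto
    then show False using g(2) del(1) by simp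
  qed
  then have "odd_reflection G (s # vs) s"
    using closed S by (simp add: involution)
  then have "odd_reflection G ws s"
    using odd_reflection_cong[of ws "s # vs" s] eq S closed by simp
  then obtain ys z zs where del: "ws = ys @ z # zs" "s \<otimes> word_prod G ws = word_prod G (ys @ zs)"
    using odd_reflection_deletion[of ws s] S closed by auto
  have "word_prod G ws = word_prod G (s # ys @ zs)"
    using del(2) involution_cancel[OF S(2) closed(4)] by (metis word_prod_Cons)
  then have "word_prod G (cs @ s # ys @ zs) = g"
    using ws(2) S del(1) word_prod_append[of cs ws] word_prod_append[of cs "s # ys @ zs"] by auto
  then show ?thesis using del(1) by blast
qed

end

lemma coxeter_system_words:
  assumes "coxeter_system W S"
  obtains m where "coxeter_words W S m"
proof -
  obtain m where grp: "group W" and m: "coxeter_matrix S m"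
    and pres: "has_presentation W S (coxeter_relators S m)"
    using assms by (auto simp: coxeter_system_def)
  interpret group W by (rule grp)
  have SW: "S \<subseteq> carrier W" using pres by (simp add: has_presentation_def)
  have inv: "s \<otimes>\<^bsub>W\<^esub> s = \<one>\<^bsub>W\<^esub>" if s: "s \<in> S" for s
  proof -
    let ?r = "[(s, True), (s, True)]"
    have "m s s = 1" using m s by (auto simp: coxeter_matrix_def)
    then have "?r \<in> coxeter_relators S m"
      using s by (force simp: coxeter_relators_def)
    then have "presentation_eq S (coxeter_relators S m) ?r []"
      using presentation_eq.relator[of ?r "coxeter_relators S m" S "[]" "[]"] by simp
    moreover have "?r \<in> lists (S \<times> UNIV)" using s by simp
    ultimately have "eval_signed_word W ?r = \<one>\<^bsub>W\<^esub>"
      using pres by (auto simp: has_presentation_def)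
    then show ?thesis using s SW by (auto simp: eval_signed_word_def)
  qed
  have "coxeter_words W S m"
    by unfold_locales (use SW inv pres in auto)
  then show thesis by (rule that)
qed

section \<open>Exchanging positions of subwords\<close>

lemma subword_eq_map:
  assumes "P \<subseteq> {1..length Q}"
  shows "subword Q P = map (\<lambda>p. Q ! (p - 1)) (sorted_list_of_set P)"
proof -
  let ?is = "filter (\<lambda>i. Suc i \<in> P) [0..<length Q]"
  have "zip Q [0..<length Q] = map (\<lambda>i. (Q ! i, i)) [0..<length Q]"
    by (intro nth_equalityI) auto
  then have "subword Q P = map (\<lambda>i. Q ! i) ?is"
    by (simp add: subword_def nths_def filter_map comp_def)
  also have "\<dots> = map (\<lambda>p. Q ! (p - 1)) (map Suc ?is)" by simp
  also have "map Suc ?is = sorted_list_of_set P"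
  proof (rule sorted_distinct_set_unique)
    show "sorted (map Suc ?is)"
      by (simp add: sorted_wrt_map sorted_wrt_filter)
    show "distinct (map Suc ?is)" by (simp add: distinct_map)
    show "set (map Suc ?is) = set (sorted_list_of_set P)"
    proof (rule Set.set_eqI)
      fix p show "p \<in> set (map Suc ?is) \<longleftrightarrow> p \<in> set (sorted_list_of_set P)"
        using assms finite_subset[OF assms] by (cases p) auto
    qed
  qed auto
  finally show ?thesis .
qed

lemma sorted_list_of_set_eq_append:
  fixes A B :: "nat set"
  assumes "finite A" "finite B" "\<forall>a\<in>A. \<forall>b\<in>B. a < b"
  shows "sorted_list_of_set (A \<union> B) = sorted_list_of_set A @ sorted_list_of_set B"
proof (rule sorted_distinct_set_unique)
  show "sorted (sorted_list_of_set A @ sorted_list_of_set B)"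
    using assms by (auto simp: sorted_append less_imp_le)
  show "distinct (sorted_list_of_set A @ sorted_list_of_set B)"
    using assms by fastforce
qed (use assms in auto)

text \<open>In increasing order, the positions of \<open>A\<close> are those of \<open>C\<close>, then \<open>l\<close>, then those of \<open>A'\<close>, and the
  positions of \<open>B\<close> are those of the same \<open>C\<close>, then those of \<open>B'\<close>. The exchange behind the prefix \<open>C\<close>
  puts \<open>l\<close> in its correct place and deletes a position of \<open>B'\<close>, which is thus greater than \<open>l\<close>. The
  new word is reduced because it is as long as the one at \<open>B\<close>.\<close>

lemma exchange_represents:
  assumes cox: "coxeter_system W S" and Q: "set Q \<subseteq> S"
    and A: "represents W S Q A g" and B: "represents W S Q B g"
    and l: "l \<in> A" "l \<notin> B" "\<forall>j<l. j \<in> A \<longleftrightarrow> j \<in> B"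
  shows "\<exists>m\<in>B. l < m \<and> represents W S Q (insert l (B - {m})) g"
proof -
  obtain m where "coxeter_words W S m" using cox by (rule coxeter_system_words)
  then interpret coxeter_words W S m .
  define f where "f p = Q ! (p - 1)" for p
  let ?sl = "sorted_list_of_set :: nat set \<Rightarrow> nat list"
  define C A' B' where "C = {j \<in> B. j < l}" and "A' = {j \<in> A. l < j}" and "B' = {j \<in> B. l < j}"
  have sub: "A \<subseteq> {1..length Q}" "B \<subseteq> {1..length Q}"
    using A B by (auto simp: represents_def)
  have fin: "finite A" "finite B" using sub finite_subset by auto
  then have fin': "finite C" "finite A'" "finite B'"
    by (auto simp: C_def A'_def B'_def)
  have sw: "subword Q P = map f (?sl P)" if "P \<subseteq> {1..length Q}" for P
    using subword_eq_map[OF that] by (simp add: f_def [abs_def])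
  have "A = C \<union> ({l} \<union> A')"
    using l by (auto simp: C_def A'_def)
  moreover have "?sl (C \<union> ({l} \<union> A')) = ?sl C @ ?sl ({l} \<union> A')"
    using fin' by (intro sorted_list_of_set_eq_append) (auto simp: C_def A'_def)
  moreover have "?sl ({l} \<union> A') = ?sl {l} @ ?sl A'"
    using fin' by (intro sorted_list_of_set_eq_append) (auto simp: A'_def)
  ultimately have slA: "?sl A = ?sl C @ l # ?sl A'" by simp
  have Bsplit: "B = C \<union> B'"
    using l by (auto simp: C_def B'_def) (metis linorder_neqE_nat)
  have "?sl (C \<union> B') = ?sl C @ ?sl B'"
    using fin' by (intro sorted_list_of_set_eq_append) (auto simp: C_def B'_def)
  then have slB: "?sl B = ?sl C @ ?sl B'" using Bsplit by simp
  have redA: "reduced_expression W S (map f (?sl C) @ f l # map f (?sl A')) g"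
    using A sw[OF sub(1)] slA by (simp add: represents_def)
  have redB: "reduced_expression W S (map f (?sl C) @ map f (?sl B')) g"
    using B sw[OF sub(2)] slB by (simp add: represents_def)
  have "set (map f (?sl C) @ map f (?sl B')) \<subseteq> S"
    "word_prod W (map f (?sl C) @ map f (?sl B')) = g"
    using redB by (auto simp: reduced_expression_def)
  from exchange_after_prefix[OF redA this]
  obtain ys z zs where del: "map f (?sl B') = ys @ z # zs"
    and prod: "word_prod W (map f (?sl C) @ f l # ys @ zs) = g" by blast
  obtain as k bs where sl: "?sl B' = as @ k # bs" "ys = map f as" "zs = map f bs"
    using del by (auto simp: map_eq_append_conv map_eq_Cons_conv)
  have sorted: "sorted (as @ k # bs)" "distinct (as @ k # bs)" "set (as @ k # bs) = B'"
    using fin' sl(1) by (metis sorted_sorted_list_of_set, metis distinct_sorted_list_of_set,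
      metis set_sorted_list_of_set)
  then have k: "k \<in> B" "l < k" by (auto simp: B'_def)
  have "B' - {k} = set (as @ bs)"
    unfolding sorted(3)[symmetric] using sorted(2) by auto
  moreover have "sorted (as @ bs)" "distinct (as @ bs)"
    using sorted(1,2) by (auto simp: sorted_append)
  ultimately have slB'': "?sl (B' - {k}) = as @ bs"
    by (simp only: sorted_list_of_set.idem_if_sorted_distinct)
  let ?P = "insert l (B - {k})"
  have "k \<notin> C" using k(2) by (simp add: C_def)
  then have "?P = C \<union> ({l} \<union> (B' - {k}))"
    unfolding Bsplit by auto
  moreover have "?sl (C \<union> ({l} \<union> (B' - {k}))) = ?sl C @ ?sl ({l} \<union> (B' - {k}))"
    using fin' by (intro sorted_list_of_set_eq_append) (auto simp: C_def B'_def)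
  moreover have "?sl ({l} \<union> (B' - {k})) = ?sl {l} @ ?sl (B' - {k})"
    using fin' by (intro sorted_list_of_set_eq_append) (auto simp: B'_def)
  ultimately have slP: "?sl ?P = ?sl C @ l # as @ bs" using slB'' by simp
  have subP: "?P \<subseteq> {1..length Q}" using sub l(1) by auto
  have "set (subword Q ?P) \<subseteq> S"
    using set_nths_subset[of Q] Q unfolding subword_def by blast
  moreover have "word_prod W (subword Q ?P) = g"
    using prod sl by (simp add: sw[OF subP] slP)
  moreover have "length (subword Q ?P) = coxeter_length W S g"
    using redB sl by (simp add: sw[OF subP] slP reduced_expression_def)
  ultimately have "represents W S Q ?P g"
    using subP by (simp add: represents_def reduced_expression_def)
  then show ?thesis using k by blast
qed

section \<open>Linear quotients\<close>

lemma lex_greater_asym: "lex_greater u v \<Longrightarrow> \<not> lex_greater v u"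
  unfolding lex_greater_def by (metis linorder_neqE_nat less_asym less_irrefl)

lemma lex_greater_mset_set_iff:
  assumes "finite A" "finite B"
  shows "lex_greater (mset_set A) (mset_set B) \<longleftrightarrow>
    (\<exists>l. l \<in> A \<and> l \<notin> B \<and> (\<forall>j<l. j \<in> A \<longleftrightarrow> j \<in> B))"
  using assms by (auto simp: lex_greater_def count_mset_set')

lemma mset_set_diff_inter:
  assumes "finite A" "finite B"
  shows "mset_set A - (mset_set B \<inter># mset_set A) = mset_set (A - B)"
  using assms by (intro multiset_eqI) (auto simp: count_mset_set')

lemma finite_represents: "represents W S Q P g \<Longrightarrow> finite P"
  using finite_subset by (auto simp: represents_def)

text \<open>All sets representing \<open>g\<close> have the same cardinality, so their monomials do not divide one
  another.\<close>

lemma minimal_generating_set_dual_subword_complex: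
  "is_minimal_monomial_generating_set (length Q)
     (stanley_reisner_ideal (length Q) (alexander_dual (length Q) (subword_complex W S Q g))
        :: (monomial \<Rightarrow>\<^sub>0 'k::field) set)
     {mset_set P | P. represents W S Q P g}" (is "is_minimal_monomial_generating_set _ _ ?A")
proof -
  have "?A \<subseteq> monomials (length Q)"
    using mset_set_monomials by (auto simp: represents_def)
  moreover have "\<forall>a\<in>?A. \<forall>b\<in>?A. a \<subseteq># b \<longrightarrow> a = b"
    by (auto simp: finite_represents card_represents card_subset_eq)
  ultimately show ?thesis
    by (intro is_minimal_monomial_generating_set_antichain_iff
      [THEN iffD2, OF _ _ stanley_reisner_ideal_dual_subword_complex HOL.refl])
qed

theorem theorem1p3:
  fixes W :: "('a, 'b) monoid_scheme" and S :: "'a set" and Q :: "'a list" and g :: 'a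
    and \<Delta> :: "nat set set" and n :: nat
    and I :: "(monomial \<Rightarrow>\<^sub>0 'k::field) set" and us :: "monomial list"
  assumes "coxeter_system W S"
    and "set Q \<subseteq> S" and "n = length Q"
    and "g \<in> carrier W"
    and "\<Delta> = subword_complex W S Q g"
    and "I = stanley_reisner_ideal n (alexander_dual n \<Delta>)"
    and "set us = minimal_generators n I"
    and "sorted_wrt lex_greater us"
  shows "has_linear_quotients n I us"
proof -
  have us: "set us = {mset_set P | P. represents W S Q P g}"
    using assms minimal_generators_dual_subword_complex[of Q W S g, where 'k = 'k] by simp
  have min: "is_minimal_monomial_generating_set n I (set us)"
    unfolding us assms(3,5,6) by (rule minimal_generating_set_dual_subword_complex)
  have greater: "lex_greater (us ! j) (us ! i)" if "j < i" "i < length us" for i j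
    using assms(8) that by (simp add: sorted_wrt_iff_nth_less)
  have "distinct us"
    using greater lex_greater_asym by (metis distinct_conv_nth linorder_neqE_nat)
  moreover have "\<exists>l\<in>{1..n}. \<exists>k<i. us ! k - (us ! i \<inter># us ! k) = {#l#} \<and>
      {#l#} \<subseteq># us ! j - (us ! i \<inter># us ! j)" if i: "i < length us" and j: "j < i" for i j
  proof -
    obtain B where B: "us ! i = mset_set B" "represents W S Q B g"
      using i us nth_mem[of i us] by auto
    obtain A where A: "us ! j = mset_set A" "represents W S Q A g"
      using i j us nth_mem[of j us] by auto
    note fin = finite_represents[OF A(2)] finite_represents[OF B(2)]
    obtain l where l: "l \<in> A" "l \<notin> B" "\<forall>j<l. j \<in> A \<longleftrightarrow> j \<in> B"
      using greater[OF j i] A B fin by (auto simp: lex_greater_mset_set_iff)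
    \<comment> \<open>\<open>?P\<close> precedes \<open>B\<close> because the inserted position \<open>l\<close> comes before the deleted \<open>m\<close>.\<close>
    obtain m where m: "m \<in> B" "l < m" "represents W S Q (insert l (B - {m})) g"
      (is "represents W S Q ?P g")
      using exchange_represents[OF assms(1,2) A(2) B(2) l] by blast
    obtain k where k: "k < length us" "us ! k = mset_set ?P"
      using m(3) us by (metis (mono_tags, lifting) in_set_conv_nth mem_Collect_eq)
    have finP: "finite ?P" using fin by simp
    have "lex_greater (us ! k) (us ! i)"
      unfolding k(2) B(1) lex_greater_mset_set_iff[OF finP fin(2)]
      using l(2) m(2) by (intro exI[of _ l]) auto
    then have "k < i"
      using greater[of i k] k(1) lex_greater_asym by (metis linorder_neqE_nat)
    moreover have "?P - B = {l}" using l(2) by auto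
    then have "us ! k - (us ! i \<inter># us ! k) = {#l#}"
      unfolding k(2) B(1) mset_set_diff_inter[OF finP fin(2)] by simp
    moreover have "{#l#} \<subseteq># us ! j - (us ! i \<inter># us ! j)"
      unfolding A(1) B(1) mset_set_diff_inter[OF fin] using fin l by simp
    moreover have "l \<in> {1..n}" using A(2) l(1) assms(3) by (auto simp: represents_def)
    ultimately show ?thesis by blast
  qed
  ultimately show ?thesis using min by (simp add: has_linear_quotients_def)
qed

end
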